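(* Let $\pi/2\le\alpha<\pi$ and $f\in\mathcal{MS}(\alpha)$. Then, for each $z$ with $|z|=r<1$, $$1+\frac{1}{2\sin\alpha}\big[M_1(r,\alpha)-M_2(r,\alpha)\big]\le\Re\left(\frac{zf'(z)}{f(z)}\right)\le1+\frac{1}{2\sin\alpha}\big[M_1(r,\alpha)+M_2(r,\alpha)\big]$$ and $$\left|\Im\left(\frac{zf'(z)}{f(z)}\right)\right|\le\frac{1}{2\sin\alpha}\log\big[N(r,\alpha)\big],$$ where $$M_1(r,\alpha)=\arcsin\left(\frac{-r^2\sin2\alpha}{\sqrt{1-2r^2\cos2\alpha+r^4}}\right),\qquad M_2(r,\alpha)=\arcsin\left(\frac{2r\sin\alpha}{\sqrt{1-2r^2\cos2\alpha+r^4}}\right),$$ $$N(r,\alpha)=\frac{\sqrt{1-2r^2\cos2\alpha+r^4}+2r\sin\alpha}{1-r^2}.$$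
   Context: $\mathbb{U}=\{z\in\mathbb{C}:|z|<1\}$. $\mathcal{A}$ is the class of functions $f(z)=z+\sum_{n=2}^\infty a_nz^n$ that are analytic and univalent in $\mathbb{U}$. For $\pi/2\le\alpha<\pi$, $\mathcal{MS}(\alpha)$ is the class of all $f\in\mathcal{A}$ such that $$1+\frac{\alpha-\pi}{2\sin\alpha}<\Re\left(\frac{zf'(z)}{f(z)}\right)<1+\frac{\alpha}{2\sin\alpha}\qquad(z\in\mathbb{U}),$$ where $zf'(z)/f(z)$ is given the value $1$ at $z=0$. Here $\arcsin$ takes values in $[-\pi/2,\pi/2]$. *)

theory Defs
  imports "HOL-Complex_Analysis.Complex_Analysis"
begin

abbreviation unit_disk :: "complex set" where
  "unit_disk \<equiv> ball 0 1"

(* The coefficient of z^(n + 2) is written a n. *)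
definition class_A :: "(complex \<Rightarrow> complex) set" where
  "class_A = {f. f holomorphic_on unit_disk \<and> inj_on f unit_disk \<and>
     (\<exists>a :: nat \<Rightarrow> complex. \<forall>z \<in> unit_disk. (\<lambda>n. a n * z ^ (n + 2)) sums (f z - z))}"

(* z f'(z) / f(z) has a removable singularity at the origin. *)
definition log_deriv_quot :: "(complex \<Rightarrow> complex) \<Rightarrow> complex \<Rightarrow> complex" where
  "log_deriv_quot f z = (if z = 0 then 1 else z * deriv f z / f z)"

definition class_MS :: "real \<Rightarrow> (complex \<Rightarrow> complex) set" where
  "class_MS \<alpha> = {f \<in> class_A. \<forall>z \<in> unit_disk.
     1 + (\<alpha> - pi) / (2 * sin \<alpha>) < Re (log_deriv_quot f z) \<and>
     Re (log_deriv_quot f z) < 1 + \<alpha> / (2 * sin \<alpha>)}"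

definition M1 :: "real \<Rightarrow> real \<Rightarrow> real" where
  "M1 r \<alpha> = arcsin (- (r ^ 2 * sin (2 * \<alpha>)) / sqrt (1 - 2 * r ^ 2 * cos (2 * \<alpha>) + r ^ 4))"

definition M2 :: "real \<Rightarrow> real \<Rightarrow> real" where
  "M2 r \<alpha> = arcsin (2 * r * sin \<alpha> / sqrt (1 - 2 * r ^ 2 * cos (2 * \<alpha>) + r ^ 4))"

definition N :: "real \<Rightarrow> real \<Rightarrow> real" where
  "N r \<alpha> = (sqrt (1 - 2 * r ^ 2 * cos (2 * \<alpha>) + r ^ 4) + 2 * r * sin \<alpha>) / (1 - r ^ 2)"

lemma class_A_iff:
  "f \<in> class_A \<longleftrightarrow> f holomorphic_on unit_disk \<and> inj_on f unit_disk \<and> f 0 = 0 \<and> deriv f 0 = 1"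
proof -
  have "(\<exists>a. \<forall>z \<in> unit_disk. (\<lambda>n. a n * z ^ (n + 2)) sums (f z - z)) \<longleftrightarrow> f 0 = 0 \<and> deriv f 0 = 1"
    if hol: "f holomorphic_on unit_disk"
  proof
    assume "\<exists>a. \<forall>z \<in> unit_disk. (\<lambda>n. a n * z ^ (n + 2)) sums (f z - z)"
    then obtain a where a: "\<And>z. z \<in> unit_disk \<Longrightarrow> (\<lambda>n. a n * z ^ (n + 2)) sums (f z - z)"
      by blast
    define c where "c n = (if n = 0 then 0 else if n = 1 then 1 else a (n - 2))" for n
    have c: "(\<lambda>n. c n * z ^ n) sums f z" if "norm z < 1" for z
    proof -
      have "(\<lambda>n. c (n + 2) * z ^ (n + 2)) sums (f z - z)"
        using a[of z] that by (simp add: c_def)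
      then have "(\<lambda>n. c n * z ^ n) sums (f z - z + (\<Sum>i<2. c i * z ^ i))"
        by (subst (asm) sums_iff_shift)
      then show ?thesis
        by (simp add: c_def numeral_2_eq_2)
    qed
    have f0: "f 0 = 0"
      using sums_unique2[OF c[of 0] powser_sums_zero[of c]] by (simp add: c_def)
    have "((\<lambda>z. \<Sum>n. c n * z ^ n) has_field_derivative (\<Sum>n. diffs c n * 0 ^ n)) (at 0)"
      by (rule termdiffs_strong'[of 1]) (use c in \<open>auto dest: sums_summable\<close>)
    then have "((\<lambda>z. \<Sum>n. c n * z ^ n) has_field_derivative 1) (at 0)"
      by (simp add: diffs_def c_def)
    then have "(f has_field_derivative 1) (at 0)"
      by (rule has_field_derivative_transform_within_open[of _ _ _ unit_disk])
        (use c in \<open>auto simp: sums_iff\<close>)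
    then show "f 0 = 0 \<and> deriv f 0 = 1"
      using f0 by (simp add: DERIV_imp_deriv)
  next
    assume n: "f 0 = 0 \<and> deriv f 0 = 1"
    define a where "a n = (deriv ^^ (n + 2)) f 0 / fact (n + 2)" for n
    have "(\<lambda>n. a n * z ^ (n + 2)) sums (f z - z)" if "z \<in> unit_disk" for z
    proof -
      have "(\<lambda>n. (deriv ^^ n) f 0 / fact n * (z - 0) ^ n) sums f z"
        by (rule holomorphic_power_series[OF hol that])
      then have "(\<lambda>n. (deriv ^^ (n + 2)) f 0 / fact (n + 2) * z ^ (n + 2)) sums
          (f z - (\<Sum>i<2. (deriv ^^ i) f 0 / fact i * z ^ i))"
        by (subst sums_iff_shift) simp
      then show ?thesis
        using n by (simp only: a_def) (simp add: numeral_2_eq_2)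
    qed
    then show "\<exists>a. \<forall>z \<in> unit_disk. (\<lambda>n. a n * z ^ (n + 2)) sums (f z - z)"
      by blast
  qed
  then show ?thesis
    unfolding class_A_def by blast
qed

end

theory Submission
  imports Defs
begin

text \<open>
  Write \<open>q z\<close> for \<open>z f'(z) / f(z)\<close> and \<open>h = 2 sin \<alpha> (q - 1)\<close>. The function \<open>h\<close> is holomorphic
  on the disk, vanishes at the origin, and its real part lies in the interval
  \<open>(\<alpha> - \<pi>, \<alpha>)\<close> of length \<open>\<pi>\<close>. So \<open>W = exp (\<i> h)\<close> maps the disk into the half-plane bounded by the
  line through \<open>0\<close> in direction \<open>exp (\<i> \<alpha>)\<close>, with \<open>W 0 = 1\<close>. The reflection of \<open>1\<close> in that line is
  \<open>exp (2 \<i> \<alpha>)\<close>, so \<open>(W - 1) / (W - exp (2 \<i> \<alpha>))\<close> is a self-map of the disk fixing \<open>0\<close>, and the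
  Schwarz lemma bounds its modulus at \<open>z\<close> by \<open>r = |z|\<close>.

  With \<open>\<theta> = Re h\<close> and \<open>v = Im h\<close> this bound reads
  \<open>(1 - r\<^sup>2) cosh v \<le> cos \<theta> - r\<^sup>2 cos (\<theta> - 2 \<alpha>)\<close> (lemma \<open>strip_Schwarz\<close>).
  Its right-hand side is \<open>R cos (\<theta> - M\<^sub>1)\<close>, where \<open>R exp (\<i> M\<^sub>1)\<close> is the polar form of
  \<open>1 - r\<^sup>2 exp (2 \<i> \<alpha>)\<close>, and \<open>1 - r\<^sup>2 = R cos M\<^sub>2\<close>. Hence
  \<open>cos M\<^sub>2 cosh v \<le> cos (\<theta> - M\<^sub>1)\<close>. Using \<open>cosh v \<ge> 1\<close> gives \<open>|\<theta> - M\<^sub>1| \<le> M\<^sub>2\<close>, the bounds on the real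
  part; using \<open>cos (\<theta> - M\<^sub>1) \<le> 1\<close> gives \<open>cosh v \<le> 1 / cos M\<^sub>2\<close>, the bound on the imaginary part,
  because \<open>N\<close> is the exponential of the inverse hyperbolic cosine of \<open>1 / cos M\<^sub>2\<close>.
\<close>

text \<open>
  Injectivity makes the zero of \<open>f\<close> at the origin the only one, and the normalization
  \<open>deriv f 0 = 1\<close> makes it simple. Hence \<open>f z = z g z\<close> with \<open>g\<close> holomorphic and free of zeros, and
  the quotient is \<open>deriv f z / g z\<close>, also at the origin.
\<close>

lemma log_deriv_quot_holomorphic:
  assumes "f \<in> class_A"
  shows "log_deriv_quot f holomorphic_on unit_disk"
proof -
  have hol: "f holomorphic_on unit_disk" and inj: "inj_on f unit_disk"
    and f0: "f 0 = 0" and d0: "deriv f 0 = 1"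
    using assms by (auto simp: class_A_iff)
  define g where "g = (\<lambda>z. if z = 0 then deriv f 0 else (f z - f 0) / (z - 0))"
  have g_hol: "g holomorphic_on unit_disk"
    unfolding g_def by (rule pole_lemma[OF hol]) simp
  have nz: "f z \<noteq> 0" if "z \<in> unit_disk" "z \<noteq> 0" for z
    using inj_onD[OF inj, of z 0] that f0 by auto
  then have g_nz: "g z \<noteq> 0" if "z \<in> unit_disk" for z
    using that by (auto simp: g_def f0 d0)
  have "(\<lambda>z. deriv f z / g z) holomorphic_on unit_disk"
    by (intro holomorphic_on_divide holomorphic_deriv hol g_hol g_nz) auto
  moreover have "deriv f z / g z = log_deriv_quot f z" for z
    by (simp add: g_def log_deriv_quot_def f0 d0)
  ultimately show ?thesis
    by simp
qed

text \<open>
  For \<open>b = 0\<close> and \<open>b = 2 * \<alpha>\<close> the factor \<open>2 * exp (- Im c)\<close> is the same, so it cancels when the two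
  distances are compared, which leaves hyperbolic and circular cosines only.
\<close>

lemma norm_exp_minus_cis_squared:
  "norm (exp (\<i> * c) - cis b) ^ 2 = 2 * exp (- Im c) * (cosh (Im c) - cos (Re c - b))"
proof -
  have "norm (exp (\<i> * c) - cis b) ^ 2
      = (exp (- Im c) * cos (Re c) - cos b) ^ 2 + (exp (- Im c) * sin (Re c) - sin b) ^ 2"
    by (simp add: cmod_power2 Re_exp Im_exp)
  also have "\<dots> = exp (- Im c) ^ 2 * ((cos (Re c))\<^sup>2 + (sin (Re c))\<^sup>2) + ((cos b)\<^sup>2 + (sin b)\<^sup>2)
      - 2 * exp (- Im c) * cos (Re c - b)"
    unfolding cos_diff by algebra
  also have "\<dots> = exp (- Im c) ^ 2 + 1 - 2 * exp (- Im c) * cos (Re c - b)"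
    by simp
  also have "\<dots> = 2 * exp (- Im c) * (cosh (Im c) - cos (Re c - b))"
    by (simp add: cosh_def algebra_simps power2_eq_square flip: exp_add)
  finally show ?thesis .
qed

text \<open>
  The Schwarz lemma transported to the vertical strip of width \<open>\<pi>\<close>: exponentiating makes the strip a
  half-plane, which the quotient of the differences from \<open>1\<close> and from its mirror image \<open>cis (2 * \<alpha>)\<close> maps to
  the unit disk.
\<close>

lemma strip_Schwarz:
  fixes \<alpha> :: real
  assumes \<alpha>: "0 < \<alpha>" "\<alpha> < pi"
    and hol: "h holomorphic_on unit_disk" and h0: "h 0 = 0"
    and strip: "\<And>z. z \<in> unit_disk \<Longrightarrow> \<alpha> - pi < Re (h z) \<and> Re (h z) < \<alpha>"
    and z: "norm z < 1"
  shows "(1 - norm z ^ 2) * cosh (Im (h z)) \<le> cos (Re (h z)) - norm z ^ 2 * cos (Re (h z) - 2 * \<alpha>)"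
proof -
  define w where "w = (\<lambda>z. (exp (\<i> * h z) - 1) / (exp (\<i> * h z) - cis (2 * \<alpha>)))"
  have near: "norm (exp (\<i> * h z) - 1) ^ 2 = 2 * exp (- Im (h z)) * (cosh (Im (h z)) - cos (Re (h z)))"
    for z using norm_exp_minus_cis_squared[of "h z" 0] by simp
  note far = norm_exp_minus_cis_squared[of "h z" "2 * \<alpha>" for z]
  have closer: "norm (exp (\<i> * h z) - 1) < norm (exp (\<i> * h z) - cis (2 * \<alpha>))"
    if "z \<in> unit_disk" for z
  proof -
    have "cos (\<alpha> - t) - cos (\<alpha> + t) = 2 * sin \<alpha> * sin t" for t
      by (simp add: cos_diff cos_add)
    from this[of "\<alpha> - Re (h z)"]
    have "cos (Re (h z)) - cos (Re (h z) - 2 * \<alpha>) = 2 * sin \<alpha> * sin (\<alpha> - Re (h z))"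
      using cos_minus[of "Re (h z) - 2 * \<alpha>"] by (simp add: algebra_simps)
    moreover have "sin (\<alpha> - Re (h z)) > 0"
      using strip[OF that] by (intro sin_gt_zero) auto
    ultimately have "cos (Re (h z)) - cos (Re (h z) - 2 * \<alpha>) > 0"
      using sin_gt_zero[OF \<alpha>] by simp
    then have "norm (exp (\<i> * h z) - 1) ^ 2 < norm (exp (\<i> * h z) - cis (2 * \<alpha>)) ^ 2"
      unfolding near far by simp
    then show ?thesis
      by (rule power_less_imp_less_base) simp
  qed
  then have den: "exp (\<i> * h z) - cis (2 * \<alpha>) \<noteq> 0" if "z \<in> unit_disk" for z
    using that by force
  have "norm (w z) \<le> norm z"
  proof (rule Schwarz_Lemma(1))
    show "w holomorphic_on unit_disk"
      unfolding w_def by (intro holomorphic_intros hol den)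
    show "norm (w z) < 1" if "norm z < 1" for z
      using closer[of z] den[of z] that by (simp add: w_def norm_divide)
  qed (use z h0 in \<open>simp_all add: w_def\<close>)
  then have "norm (exp (\<i> * h z) - 1) \<le> norm z * norm (exp (\<i> * h z) - cis (2 * \<alpha>))"
    using den[of z] z by (simp add: w_def norm_divide divide_le_eq)
  then have "norm (exp (\<i> * h z) - 1) ^ 2 \<le> norm z ^ 2 * norm (exp (\<i> * h z) - cis (2 * \<alpha>)) ^ 2"
    by (metis norm_ge_zero power_mono power_mult_distrib)
  then have "2 * exp (- Im (h z)) * (cosh (Im (h z)) - cos (Re (h z)))
      \<le> 2 * exp (- Im (h z)) * (norm z ^ 2 * (cosh (Im (h z)) - cos (Re (h z) - 2 * \<alpha>)))"
    unfolding near far by (simp add: mult_ac)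
  then have "cosh (Im (h z)) - cos (Re (h z)) \<le> norm z ^ 2 * (cosh (Im (h z)) - cos (Re (h z) - 2 * \<alpha>))"
    by (subst (asm) mult_le_cancel_left_pos) auto
  then show ?thesis
    by (simp add: algebra_simps)
qed

lemma abs_leg_le_hypotenuse:
  fixes a b R :: real
  assumes "R > 0" "a ^ 2 + b ^ 2 = R ^ 2"
  shows "\<bar>b\<bar> \<le> R"
proof -
  have "b ^ 2 \<le> R ^ 2"
    unfolding assms(2)[symmetric] by simp
  then show ?thesis
    using assms(1) by (simp add: abs_le_square_iff[symmetric])
qed

lemma cos_sin_arcsin_divide:
  fixes a b R :: real
  assumes "R > 0" "a \<ge> 0" "a ^ 2 + b ^ 2 = R ^ 2"
  shows "sin (arcsin (b / R)) = b / R" "cos (arcsin (b / R)) = a / R"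
proof -
  have "\<bar>b\<bar> \<le> R"
    using assms(1,3) by (rule abs_leg_le_hypotenuse)
  then have b: "- 1 \<le> b / R" "b / R \<le> 1"
    using assms by (auto simp: field_simps)
  then show "sin (arcsin (b / R)) = b / R"
    by simp
  have "1 - (b / R)\<^sup>2 = (a / R)\<^sup>2"
    using assms by (simp add: field_simps)
  then show "cos (arcsin (b / R)) = a / R"
    using assms b by (simp add: cos_arcsin)
qed

text \<open>
  The cosine determines the angle only up to sign and multiples of \<open>2 \<pi>\<close>. The bound \<open>3 \<pi> / 2\<close> together
  with \<open>cos t > 0\<close> leaves only the branch around \<open>0\<close>. For \<open>t = \<theta> - M\<^sub>1\<close> this bound holds because
  \<open>|\<theta>| < \<pi>\<close> and \<open>|M\<^sub>1| \<le> \<pi> / 2\<close>.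
\<close>

lemma abs_le_if_cos_ge:
  fixes t m :: real
  assumes "cos m \<le> cos t" "0 < cos t" "\<bar>t\<bar> < 3 * pi / 2" "0 \<le> m" "m \<le> pi"
  shows "\<bar>t\<bar> \<le> m"
proof (rule ccontr)
  assume "\<not> \<bar>t\<bar> \<le> m"
  have "\<bar>t\<bar> \<le> pi"
  proof (rule ccontr)
    assume "\<not> \<bar>t\<bar> \<le> pi"
    then have "cos (\<bar>t\<bar> - pi) > 0"
      using assms(3) by (intro cos_gt_zero_pi) auto
    then show False
      using assms(2) by (simp add: cos_diff)
  qed
  then have "cos \<bar>t\<bar> < cos m"
    using \<open>\<not> \<bar>t\<bar> \<le> m\<close> assms by (intro cos_monotone_0_pi) auto
  then show False
    using assms(1) by simp
qed

lemma abs_le_ln_if_cosh_le: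
  fixes v x :: real
  assumes "cosh v \<le> x"
  shows "\<bar>v\<bar> \<le> ln (x + sqrt (x ^ 2 - 1))"
proof -
  have x: "x \<ge> 1"
    using assms cosh_real_ge_1[of v] by linarith
  have "\<bar>v\<bar> = arcosh (cosh \<bar>v\<bar>)"
    by (rule arcosh_cosh_real[symmetric]) simp
  also have "\<dots> \<le> arcosh x"
    using assms arcosh_less_iff_real[OF x cosh_real_ge_1[of v]]
    unfolding cosh_real_abs by linarith
  finally show ?thesis
    using x by (simp add: arcosh_real_def)
qed

theorem theorem5:
  fixes \<alpha> r :: real and f :: "complex \<Rightarrow> complex" and z :: complex
  assumes "pi / 2 \<le> \<alpha>" and "\<alpha> < pi"
    and "f \<in> class_MS \<alpha>"
    and "norm z = r" and "r < 1"
  shows "1 + 1 / (2 * sin \<alpha>) * (M1 r \<alpha> - M2 r \<alpha>) \<le> Re (log_deriv_quot f z) \<and>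
    Re (log_deriv_quot f z) \<le> 1 + 1 / (2 * sin \<alpha>) * (M1 r \<alpha> + M2 r \<alpha>) \<and>
    \<bar>Im (log_deriv_quot f z)\<bar> \<le> 1 / (2 * sin \<alpha>) * ln (N r \<alpha>)"
proof -
  have \<alpha>: "0 < \<alpha>" "\<alpha> < pi"
    using assms(1,2) pi_gt_zero by linarith+
  have s: "sin \<alpha> > 0"
    by (rule sin_gt_zero[OF \<alpha>])
  have r: "0 \<le> r" "r < 1" and r2: "r\<^sup>2 < 1"
    using assms(4,5) by (auto simp: abs_square_less_1)
  define h where "h = (\<lambda>z. of_real (2 * sin \<alpha>) * (log_deriv_quot f z - 1))"
  define \<theta> v where "\<theta> = Re (h z)" and "v = Im (h z)"
  have h_hol: "h holomorphic_on unit_disk"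
    unfolding h_def using assms(3)
    by (intro holomorphic_intros log_deriv_quot_holomorphic) (simp add: class_MS_def)
  have Re_h: "Re (h u) = 2 * sin \<alpha> * (Re (log_deriv_quot f u) - 1)" for u
    by (simp add: h_def)
  have strip: "\<alpha> - pi < Re (h u) \<and> Re (h u) < \<alpha>" if "u \<in> unit_disk" for u
  proof -
    have "(\<alpha> - pi) / (2 * sin \<alpha>) < Re (log_deriv_quot f u) - 1
        \<and> Re (log_deriv_quot f u) - 1 < \<alpha> / (2 * sin \<alpha>)"
      using assms(3) that by (force simp: class_MS_def)
    then show ?thesis
      using s by (simp add: Re_h pos_divide_less_eq pos_less_divide_eq mult_ac)
  qed
  have schwarz: "(1 - r\<^sup>2) * cosh v \<le> cos \<theta> - r\<^sup>2 * cos (\<theta> - 2 * \<alpha>)"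
    using strip_Schwarz[OF \<alpha> h_hol _ strip, of z] assms(4,5)
    by (simp add: \<theta>_def v_def) (simp add: h_def log_deriv_quot_def)

  \<comment> \<open>\<open>R\<close> is the modulus of \<open>1 - r\<^sup>2 * cis (2 * \<alpha>)\<close>, and it is also the hypotenuse over the legs
    \<open>1 - r\<^sup>2\<close> and \<open>2 * r * sin \<alpha>\<close>; the two angles are \<open>M1\<close> and \<open>M2\<close>.\<close>
  define R where "R = sqrt (1 - 2 * r ^ 2 * cos (2 * \<alpha>) + r ^ 4)"
  have R2_M2: "(1 - r\<^sup>2)\<^sup>2 + (2 * r * sin \<alpha>)\<^sup>2 = 1 - 2 * r ^ 2 * cos (2 * \<alpha>) + r ^ 4"
    unfolding cos_double_sin by algebra
  have "0 < (1 - r\<^sup>2)\<^sup>2 + (2 * r * sin \<alpha>)\<^sup>2"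
    using r2 by (intro add_pos_nonneg) auto
  then have R: "R > 0" and R2: "R\<^sup>2 = 1 - 2 * r ^ 2 * cos (2 * \<alpha>) + r ^ 4"
    unfolding R_def R2_M2 by auto
  have "(1 - r\<^sup>2 * cos (2 * \<alpha>))\<^sup>2 + (- (r\<^sup>2 * sin (2 * \<alpha>)))\<^sup>2
      = 1 - 2 * r ^ 2 * cos (2 * \<alpha>) + r ^ 4 * ((cos (2 * \<alpha>))\<^sup>2 + (sin (2 * \<alpha>))\<^sup>2)"
    by (simp only: power2_eq_square) (simp add: algebra_simps eval_nat_numeral
      del: sin_cos_squared_add sin_cos_squared_add2 sin_cos_squared_add3)
  then have R2_M1: "(1 - r\<^sup>2 * cos (2 * \<alpha>))\<^sup>2 + (- (r\<^sup>2 * sin (2 * \<alpha>)))\<^sup>2 = R\<^sup>2"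
    by (simp add: R2)
  have "r\<^sup>2 * cos (2 * \<alpha>) \<le> 1"
    using r2 mult_left_mono[OF cos_le_one[of "2 * \<alpha>"], of "r\<^sup>2"] by simp
  \<comment> \<open>The real part \<open>1 - r\<^sup>2 * cos (2 * \<alpha>)\<close> is nonnegative, so the arcsine gives the correct argument.\<close>
  then have M1: "sin (M1 r \<alpha>) = - (r\<^sup>2 * sin (2 * \<alpha>)) / R" "cos (M1 r \<alpha>) = (1 - r\<^sup>2 * cos (2 * \<alpha>)) / R"
    using cos_sin_arcsin_divide[OF R _ R2_M1] unfolding M1_def R_def by auto
  have M2: "cos (M2 r \<alpha>) = (1 - r\<^sup>2) / R"
    using cos_sin_arcsin_divide(2)[of R "1 - r\<^sup>2" "2 * r * sin \<alpha>"] R R2 R2_M2 r2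
    unfolding M2_def R_def by auto
  have legs_le: "\<bar>2 * r * sin \<alpha>\<bar> \<le> R" "\<bar>- (r\<^sup>2 * sin (2 * \<alpha>))\<bar> \<le> R"
    by (rule abs_leg_le_hypotenuse[OF R], rule R2_M2[folded R2])
      (rule abs_leg_le_hypotenuse[OF R R2_M1])
  have M1_range: "- pi / 2 \<le> M1 r \<alpha>" "M1 r \<alpha> \<le> pi / 2"
    using arcsin_bounded[of "- (r\<^sup>2 * sin (2 * \<alpha>)) / R"] R legs_le(2)
    unfolding M1_def R_def[symmetric] by (auto simp: field_simps)
  have "0 \<le> 2 * r * sin \<alpha> / R" "2 * r * sin \<alpha> / R \<le> 1"
    using R r s legs_le(1) by (simp_all add: divide_le_eq)
  then have M2_range: "0 \<le> M2 r \<alpha>" "M2 r \<alpha> \<le> pi / 2"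
    using arcsin_le_arcsin[of 0 "2 * r * sin \<alpha> / R"] arcsin_ubound[of "2 * r * sin \<alpha> / R"]
    unfolding M2_def R_def[symmetric] by simp_all

  have "cos (\<theta> - M1 r \<alpha>) = (cos \<theta> - r\<^sup>2 * cos (\<theta> - 2 * \<alpha>)) / R"
    unfolding cos_diff M1 using R by (simp add: field_simps)
  then have key: "cos (M2 r \<alpha>) * cosh v \<le> cos (\<theta> - M1 r \<alpha>)"
    unfolding M2 using schwarz R by (simp add: divide_right_mono)
  have cM2: "0 < cos (M2 r \<alpha>)"
    unfolding M2 using R r2 by simp

  have "cos (M2 r \<alpha>) \<le> cos (M2 r \<alpha>) * cosh v"
    using cM2 cosh_real_ge_1[of v] by simp
  then have cos_le: "cos (M2 r \<alpha>) \<le> cos (\<theta> - M1 r \<alpha>)"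
    using key by linarith
  have "\<alpha> - pi < \<theta>" "\<theta> < \<alpha>"
    using strip[of z] assms(4,5) by (simp_all add: \<theta>_def)
  then have "\<bar>\<theta> - M1 r \<alpha>\<bar> < 3 * pi / 2"
    using M1_range \<alpha> by linarith
  then have "\<bar>\<theta> - M1 r \<alpha>\<bar> \<le> M2 r \<alpha>"
    using cos_le cM2 M2_range by (intro abs_le_if_cos_ge) auto
  then have re: "M1 r \<alpha> - M2 r \<alpha> \<le> 2 * sin \<alpha> * (Re (log_deriv_quot f z) - 1)"
    "2 * sin \<alpha> * (Re (log_deriv_quot f z) - 1) \<le> M1 r \<alpha> + M2 r \<alpha>"
    unfolding \<theta>_def Re_h by auto

  have "cos (M2 r \<alpha>) * cosh v \<le> 1"
    using key cos_le_one order_trans by blast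
  then have "cosh v \<le> R / (1 - r\<^sup>2)"
    unfolding M2 using R r2 by (simp add: field_simps)
  then have "\<bar>v\<bar> \<le> ln (R / (1 - r\<^sup>2) + sqrt ((R / (1 - r\<^sup>2))\<^sup>2 - 1))"
    by (rule abs_le_ln_if_cosh_le)
  also have "(R / (1 - r\<^sup>2))\<^sup>2 - 1 = (2 * r * sin \<alpha> / (1 - r\<^sup>2))\<^sup>2"
    using r2 R2_M2 unfolding power_divide R2 by (simp add: field_simps)
  also have "sqrt \<dots> = 2 * r * sin \<alpha> / (1 - r\<^sup>2)"
    using r r2 s by simp
  also have "R / (1 - r\<^sup>2) + 2 * r * sin \<alpha> / (1 - r\<^sup>2) = N r \<alpha>"
    unfolding N_def R_def by (simp add: add_divide_distrib)
  also have "\<bar>v\<bar> = 2 * sin \<alpha> * \<bar>Im (log_deriv_quot f z)\<bar>"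
    using s by (simp add: v_def h_def abs_mult)
  finally have im: "2 * sin \<alpha> * \<bar>Im (log_deriv_quot f z)\<bar> \<le> ln (N r \<alpha>)" .

  show ?thesis
    using re im s by (simp add: field_simps)
qed

end
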